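(* Let $D\subseteq\mathbb{R}$ be an interval with nonempty interior, $T>0$, and let $F\in C^1(\mathbb{R})$ be a known function. Let $u\in C^1([0,T]\times D)$ be a given function which, for some $\alpha\in C^1(D)$, satisfies $$\frac{\partial}{\partial t}u(t,x)+\frac{\partial}{\partial x}\Big(\alpha(x)F(u(t,x))\Big)=0,\qquad \forall (t,x)\in[0,T]\times D. \quad (\ast)$$ If there exist no nonempty open interval $\Omega\subseteq D$ and nonempty open interval $(T_1,T_2)\subseteq(0,T]$ such that $F(u(t,x))$ is separable on $(T_1,T_2)\times\Omega$, then $\alpha$ is unique, i.e. $\alpha$ is the only function in $C^1(D)$ for which $(\ast)$ holds with the given $u$.
   Context: A $C^1$ function $h$ of two variables $(t,x)\in(T_1,T_2)\times\Omega$ is called separable on $(T_1,T_2)\times\Omega$ if there exist $f\in C^1(T_1,T_2)$ and $g\in C^1(\Omega)$ such that $h(t,x)=f(t)g(x)$ for all $(t,x)\in(T_1,T_2)\times\Omega$. *)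

theory Defs imports "HOL-Analysis.Analysis" begin

(* Derivatives are taken within S, hence one-sided at boundary points of S that belong to S.
   (The library's C1_differentiable_on uses two-sided derivatives of the total function, which
   would depend on the values outside S.) *)
definition C1_on :: "('a::real_normed_vector \<Rightarrow> 'b::real_normed_vector) \<Rightarrow> 'a set \<Rightarrow> bool" where
  "C1_on f S \<longleftrightarrow> (\<exists>f' :: 'a \<Rightarrow> 'a \<Rightarrow>\<^sub>L 'b.
     (\<forall>x\<in>S. (f has_derivative blinfun_apply (f' x)) (at x within S)) \<and> continuous_on S f')"

(* C^1 regularity of h itself is not demanded separately: it follows from that of f and g. *)
definition separable_on :: "(real \<times> real \<Rightarrow> real) \<Rightarrow> real set \<Rightarrow> real set \<Rightarrow> bool" where
  "separable_on h I \<Omega> \<longleftrightarrow> (\<exists>f g. C1_on f I \<and> C1_on g \<Omega> \<and>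
     (\<forall>t\<in>I. \<forall>x\<in>\<Omega>. h (t, x) = f t * g x))"

definition conservation_law ::
  "real \<Rightarrow> real set \<Rightarrow> (real \<Rightarrow> real) \<Rightarrow> (real \<times> real \<Rightarrow> real) \<Rightarrow> (real \<Rightarrow> real) \<Rightarrow> bool" where
  "conservation_law T D F u \<alpha> \<longleftrightarrow> (\<forall>t\<in>{0..T}. \<forall>x\<in>D. \<exists>ut fx.
     ((\<lambda>s. u (s, x)) has_real_derivative ut) (at t within {0..T}) \<and>
     ((\<lambda>y. \<alpha> y * F (u (t, y))) has_real_derivative fx) (at x within D) \<and>
     ut + fx = 0)"

end

theory Submission imports Defs begin

text \<open>If \<open>\<alpha>\<close> and \<open>\<beta>\<close> both solve the equation, then \<open>\<gamma> = \<beta> - \<alpha>\<close> makes \<open>\<gamma>(x) F(u(t,x))\<close>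
  independent of \<open>x\<close>. If \<open>\<gamma>(x0) \<noteq> 0\<close>, then near \<open>x0\<close> we may divide by \<open>\<gamma>\<close> and obtain the
  separation \<open>F(u(t,x)) = (\<gamma>(x0) F(u(t,x0))) \<cdot> (1 / \<gamma>(x))\<close>.\<close>

lemma C1_on_subset:
  assumes "C1_on f S" "R \<subseteq> S"
  shows "C1_on f R"
proof -
  obtain f' where f': "\<And>x. x \<in> S \<Longrightarrow> (f has_derivative blinfun_apply (f' x)) (at x within S)"
    and cf': "continuous_on S f'"
    using assms(1) unfolding C1_on_def by blast
  have "(f has_derivative blinfun_apply (f' x)) (at x within R)" if "x \<in> R" for x
    by (rule has_derivative_subset[OF f'[OF subsetD[OF assms(2) that]] assms(2)])
  moreover have "continuous_on R f'"
    by (rule continuous_on_subset[OF cf' assms(2)])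
  ultimately show ?thesis
    unfolding C1_on_def by (intro exI[of _ f']) simp
qed

lemma C1_on_imp_continuous_on:
  assumes "C1_on f S"
  shows "continuous_on S f"
proof -
  obtain f' where "\<And>x. x \<in> S \<Longrightarrow> (f has_derivative blinfun_apply (f' x)) (at x within S)"
    using assms unfolding C1_on_def by blast
  then show ?thesis by (rule has_derivative_continuous_on)
qed

lemma C1_on_compose:
  assumes f: "C1_on f S" and g: "C1_on g R" and fSR: "f ` S \<subseteq> R"
  shows "C1_on (\<lambda>x. g (f x)) S"
proof -
  obtain f' where f': "\<And>x. x \<in> S \<Longrightarrow> (f has_derivative blinfun_apply (f' x)) (at x within S)"
    and cf': "continuous_on S f'"
    using f unfolding C1_on_def by blast
  obtain g' where g': "\<And>y. y \<in> R \<Longrightarrow> (g has_derivative blinfun_apply (g' y)) (at y within R)"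
    and cg': "continuous_on R g'"
    using g unfolding C1_on_def by blast
  have "((\<lambda>x. g (f x)) has_derivative blinfun_apply (g' (f x) o\<^sub>L f' x)) (at x within S)"
    if x: "x \<in> S" for x
  proof -
    \<comment> \<open>The chain rule within sets asks for the outer derivative within the image of
      \<open>S\<close>; since that image lies in \<open>R\<close>, restricting the derivative within
      \<open>R\<close> provides it.\<close>
    have "(g has_derivative blinfun_apply (g' (f x))) (at (f x) within f ` S)"
      using g' x fSR by (meson has_derivative_subset imageI subsetD)
    from has_derivative_in_compose[OF f'[OF x] this] show ?thesis
      by (simp add: blinfun_compose.rep_eq o_def)
  qed
  \<comment> \<open>Composition of bounded operators is bounded bilinear, so it preserves continuity
    of its two factors.\<close>
  moreover have "continuous_on S (\<lambda>x. g' (f x) o\<^sub>L f' x)"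
    by (intro bounded_bilinear.continuous_on[OF bounded_bilinear_blinfun_compose] cf'
        continuous_on_compose2[OF cg' C1_on_imp_continuous_on[OF f] fSR])
  ultimately show ?thesis unfolding C1_on_def
    by (intro exI[of _ "\<lambda>x. g' (f x) o\<^sub>L f' x"]) auto
qed

text \<open>The derivative of an affine map is constant. This serves both the curve
  \<open>t \<mapsto> (t, x0)\<close> and multiplication by a fixed scalar.\<close>

lemma C1_on_bounded_linear:
  assumes "bounded_linear f"
  shows "C1_on (\<lambda>x. f x + c) S"
proof -
  have "((\<lambda>x. f x + c) has_derivative blinfun_apply (Blinfun f)) (at x within S)" for x
    using assms by (auto simp: bounded_linear_Blinfun_apply intro!: derivative_eq_intros
        bounded_linear.has_derivative[OF assms])
  then show ?thesis unfolding C1_on_def by (intro exI[of _ "\<lambda>_. Blinfun f"]) auto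
qed

text \<open>This and the next lemma pass between operator-valued and scalar derivatives: a linear
  map on the reals is multiplication by a number, and the correspondence is continuous both
  ways.\<close>

lemma C1_on_realI:
  fixes f f' :: "real \<Rightarrow> real"
  assumes "\<And>x. x \<in> S \<Longrightarrow> (f has_real_derivative f' x) (at x within S)" "continuous_on S f'"
  shows "C1_on f S"
  unfolding C1_on_def
proof (intro exI conjI ballI)
  show "(f has_derivative blinfun_apply (blinfun_mult_right (f' x))) (at x within S)"
    if "x \<in> S" for x
    using assms(1)[OF that] by (simp add: has_field_derivative_def)
  show "continuous_on S (\<lambda>x. blinfun_mult_right (f' x))"
    by (intro bounded_linear.continuous_on[OF bounded_linear_blinfun_mult_right] assms(2))
qed

lemma C1_on_realE:
  fixes f :: "real \<Rightarrow> real"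
  assumes "C1_on f S"
  obtains f' where "\<And>x. x \<in> S \<Longrightarrow> (f has_real_derivative f' x) (at x within S)"
    and "continuous_on S f'"
proof -
  obtain F where F: "\<And>x. x \<in> S \<Longrightarrow> (f has_derivative blinfun_apply (F x)) (at x within S)"
    and cF: "continuous_on S F"
    using assms unfolding C1_on_def by blast
  \<comment> \<open>By homogeneity the operator is determined by its value at 1, which becomes the
    scalar derivative.\<close>
  have "blinfun_apply (F x) = (*) (blinfun_apply (F x) 1)" for x
  proof
    show "blinfun_apply (F x) y = blinfun_apply (F x) 1 * y" for y
      using blinfun.scaleR_right[of "F x" y 1] by simp
  qed
  then have "(f has_real_derivative blinfun_apply (F x) 1) (at x within S)" if "x \<in> S" for x
    using F[OF that] by (metis has_field_derivative_def)
  moreover have "continuous_on S (\<lambda>x. blinfun_apply (F x) 1)"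
    using cF by (intro continuous_intros)
  ultimately show thesis by (rule that)
qed

lemma C1_on_diff:
  fixes f g :: "real \<Rightarrow> real"
  assumes "C1_on f S" "C1_on g S"
  shows "C1_on (\<lambda>x. f x - g x) S"
proof -
  obtain f' g' where "\<And>x. x \<in> S \<Longrightarrow> (f has_real_derivative f' x) (at x within S)" "continuous_on S f'"
    and "\<And>x. x \<in> S \<Longrightarrow> (g has_real_derivative g' x) (at x within S)" "continuous_on S g'"
    using C1_on_realE[OF assms(1)] C1_on_realE[OF assms(2)] by metis
  then show ?thesis
    by (intro C1_on_realI[where f' = "\<lambda>x. f' x - g' x"] DERIV_diff continuous_on_diff) auto
qed

lemma C1_on_inverse:
  fixes f :: "real \<Rightarrow> real"
  assumes "C1_on f S" "\<And>x. x \<in> S \<Longrightarrow> f x \<noteq> 0"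
  shows "C1_on (\<lambda>x. inverse (f x)) S"
proof -
  obtain f' where f': "\<And>x. x \<in> S \<Longrightarrow> (f has_real_derivative f' x) (at x within S)"
    and cf': "continuous_on S f'"
    using C1_on_realE[OF assms(1)] by blast
  show ?thesis
  proof (rule C1_on_realI)
    show "((\<lambda>x. inverse (f x)) has_real_derivative - (inverse (f x) * f' x * inverse (f x)))
        (at x within S)" if "x \<in> S" for x
      using f'[OF that] assms(2)[OF that] by (auto intro!: derivative_eq_intros)
    show "continuous_on S (\<lambda>x. - (inverse (f x) * f' x * inverse (f x)))"
      using cf' assms C1_on_imp_continuous_on by (intro continuous_intros) auto
  qed
qed

text \<open>Both equations contain the same time derivative of \<open>u\<close>, so subtracting them
  leaves a flux difference with zero space derivative within \<open>D\<close>. On a convex set such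
  a function is constant.\<close>

lemma conservation_law_diff_const:
  assumes "is_interval D" "T > 0"
    and \<alpha>: "conservation_law T D F u \<alpha>" and \<beta>: "conservation_law T D F u \<beta>"
    and t: "t \<in> {0..T}" and xy: "x \<in> D" "y \<in> D"
  shows "(\<beta> x - \<alpha> x) * F (u (t, x)) = (\<beta> y - \<alpha> y) * F (u (t, y))"
proof -
  have "((\<lambda>z. (\<beta> z - \<alpha> z) * F (u (t, z))) has_real_derivative 0) (at x within D)"
    if x: "x \<in> D" for x
  proof -
    obtain ut fx where a: "((\<lambda>s. u (s, x)) has_real_derivative ut) (at t within {0..T})"
        "((\<lambda>y. \<alpha> y * F (u (t, y))) has_real_derivative fx) (at x within D)" "ut + fx = 0"
      using \<alpha> t x unfolding conservation_law_def by blast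
    obtain vt gx where b: "((\<lambda>s. u (s, x)) has_real_derivative vt) (at t within {0..T})"
        "((\<lambda>y. \<beta> y * F (u (t, y))) has_real_derivative gx) (at x within D)" "vt + gx = 0"
      using \<beta> t x unfolding conservation_law_def by blast
    \<comment> \<open>Derivatives within a set are unique only at its limit points;
      \<open>T > 0\<close> makes every point of \<open>{0..T}\<close> one, the endpoints
      included.\<close>
    have "at t within {0..T} \<noteq> bot"
      using t \<open>T > 0\<close> by (simp add: trivial_limit_within)
    then have "ut = vt" using a(1) b(1) by (metis has_field_derivative_unique)
    then have "gx - fx = 0" using a(3) b(3) by simp
    with DERIV_diff[OF b(2) a(2)] show ?thesis
      by (simp add: left_diff_distrib)
  qed
  from has_field_derivative_zero_constant[OF is_interval_convex[OF assms(1)] this]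
  obtain c where "\<And>z. z \<in> D \<Longrightarrow> (\<beta> z - \<alpha> z) * F (u (t, z)) = c" by blast
  with xy show ?thesis by simp
qed

text \<open>Continuity keeps \<open>f\<close> nonzero on the part of a ball around \<open>x\<close>
  inside \<open>D\<close>, but \<open>x\<close> may be an endpoint of \<open>D\<close>. The ball is
  therefore cut with \<open>interior D\<close>; it meets this set because a convex set with nonempty
  interior lies in the closure of its interior.\<close>

lemma interval_nhd_nonzero:
  fixes f :: "real \<Rightarrow> real"
  assumes "is_interval D" "interior D \<noteq> {}" "continuous_on D f" "x \<in> D" "f x \<noteq> 0"
  obtains \<Omega> where "is_interval \<Omega>" "open \<Omega>" "\<Omega> \<noteq> {}" "\<Omega> \<subseteq> D" "\<And>y. y \<in> \<Omega> \<Longrightarrow> f y \<noteq> 0"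
proof -
  obtain e where e: "e > 0" "\<And>y. y \<in> D \<Longrightarrow> dist x y < e \<Longrightarrow> f y \<noteq> 0"
    using continuous_on_avoid[OF assms(3-5)] by blast
  have "x \<in> closure (interior D)"
    using assms by (metis closure_subset convex_closure_interior is_interval_convex subsetD)
  then obtain y where "y \<in> interior D" "dist y x < e"
    using e(1) unfolding closure_approachable by blast
  then have "ball x e \<inter> interior D \<noteq> {}" by (auto simp: dist_commute)
  moreover have "is_interval (ball x e \<inter> interior D)"
    using assms(1) by (simp add: is_interval_convex_1 convex_Int)
  ultimately show thesis
    using that[of "ball x e \<inter> interior D"] e(2) interior_subset[of D] by auto
qed

theorem theorem3p3:
  fixes D :: "real set" and T :: real
    and F \<alpha> :: "real \<Rightarrow> real" and u :: "real \<times> real \<Rightarrow> real"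
  assumes "is_interval D" and "interior D \<noteq> {}" and "T > 0"
    and "C1_on F UNIV"
    and "C1_on u ({0..T} \<times> D)"
    and "C1_on \<alpha> D" and "conservation_law T D F u \<alpha>"
    and "\<not> (\<exists>\<Omega> T1 T2. is_interval \<Omega> \<and> open \<Omega> \<and> \<Omega> \<noteq> {} \<and> \<Omega> \<subseteq> D \<and>
              T1 < T2 \<and> {T1<..<T2} \<subseteq> {0<..T} \<and>
              separable_on (\<lambda>p. F (u p)) {T1<..<T2} \<Omega>)"
  shows "\<forall>\<beta>. C1_on \<beta> D \<and> conservation_law T D F u \<beta> \<longrightarrow> (\<forall>x\<in>D. \<beta> x = \<alpha> x)"
proof (intro allI impI ballI, rule ccontr)
  fix \<beta> x0
  assume "C1_on \<beta> D \<and> conservation_law T D F u \<beta>" and x0: "x0 \<in> D" and "\<beta> x0 \<noteq> \<alpha> x0"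
  then have \<beta>: "C1_on \<beta> D" "conservation_law T D F u \<beta>" by auto
  define \<gamma> where "\<gamma> x = \<beta> x - \<alpha> x" for x
  have \<gamma>: "C1_on \<gamma> D" unfolding \<gamma>_def by (intro C1_on_diff \<beta> assms)
  have \<gamma>x0: "\<gamma> x0 \<noteq> 0" using \<open>\<beta> x0 \<noteq> \<alpha> x0\<close> by (simp add: \<gamma>_def)
  obtain \<Omega> where \<Omega>: "is_interval \<Omega>" "open \<Omega>" "\<Omega> \<noteq> {}" "\<Omega> \<subseteq> D" "\<And>y. y \<in> \<Omega> \<Longrightarrow> \<gamma> y \<noteq> 0"
    using interval_nhd_nonzero[OF assms(1,2) C1_on_imp_continuous_on[OF \<gamma>] x0 \<gamma>x0] by blast
  \<comment> \<open>Since \<open>\<gamma>\<close> does not depend on time, only the space variable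
    has to be localized and all of \<open>{0<..<T}\<close> can be used.\<close>
  have "separable_on (\<lambda>p. F (u p)) {0<..<T} \<Omega>"
    unfolding separable_on_def
  proof (intro exI conjI ballI)
    \<comment> \<open>The curve is the linear embedding \<open>t \<mapsto> (t, 0)\<close> shifted by
      \<open>(0, x0)\<close>.\<close>
    have "C1_on (\<lambda>t. (t, x0)) {0<..<T}"
      using C1_on_bounded_linear[of "\<lambda>t. (t, 0)" "(0, x0)"]
      by (simp add: bounded_linear_Pair)
    then have "C1_on (\<lambda>t. u (t, x0)) {0<..<T}"
      by (rule C1_on_compose[OF _ assms(5)]) (use x0 in auto)
    then have "C1_on (\<lambda>t. F (u (t, x0))) {0<..<T}"
      by (rule C1_on_compose[OF _ assms(4)]) simp
    \<comment> \<open>Scaling by \<open>\<gamma> x0\<close> is composition with a linear map, taken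
      with shift 0.\<close>
    then show "C1_on (\<lambda>t. \<gamma> x0 * F (u (t, x0))) {0<..<T}"
      using C1_on_compose[OF _ C1_on_bounded_linear[OF bounded_linear_mult_right, of _ 0 UNIV]]
      by simp
    show "C1_on (\<lambda>x. inverse (\<gamma> x)) \<Omega>"
      by (rule C1_on_inverse[OF C1_on_subset[OF \<gamma> \<Omega>(4)] \<Omega>(5)])
    fix t x assume tx: "t \<in> {0<..<T}" "x \<in> \<Omega>"
    \<comment> \<open>The point \<open>x0\<close> may lie outside \<open>\<Omega>\<close>, for
      instance at an endpoint of \<open>D\<close>; the comparison still works because constancy in
      space holds on all of \<open>D\<close>.\<close>
    then have "\<gamma> x * F (u (t, x)) = \<gamma> x0 * F (u (t, x0))"
      unfolding \<gamma>_def using \<Omega>(4) x0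
      by (intro conservation_law_diff_const[OF assms(1,3,7) \<beta>(2)]) auto
    then show "F (u (t, x)) = \<gamma> x0 * F (u (t, x0)) * inverse (\<gamma> x)"
      using \<Omega>(5)[OF tx(2)] by (simp add: field_simps)
  qed
  moreover have "{0<..<T} \<subseteq> {0<..T}" by auto
  ultimately show False using assms(3,8) \<Omega>(1-4) by blast
qed

end
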